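(* Let $k\geqslant 2$ and $d\geqslant 1$ be integers and let $F(z)\in\mathbb{C}[[z]]$ be a nonzero $k$-Mahler function converging inside the unit disc and satisfying $$a_0(z)F(z)+a_1(z)F(z^k)+\cdots+a_d(z)F(z^{k^d})=0,$$ for polynomials $a_0(z),\ldots,a_d(z)\in\mathbb{C}[z]$. Set $a_i:=a_i(1)$ for $i=0,\ldots,d$ and $$p_F(\lambda):=a_0\lambda^d+a_1\lambda^{d-1}+\cdots+a_{d-1}\lambda+a_d.$$ Suppose that $a_0a_d\neq 0$ and that $p_F(\lambda)$ has $d$ distinct roots in $\mathbb{C}$. If at least one of the following holds, then $F(z)$ is transcendental over $\mathbb{C}(z)$: (i) $p_F(k^n)\neq 0$ for all $n\in\mathbb{Z}$; (ii) $F(z)$ has eigenvalue $\lambda_F$ with $\lambda_F\neq k^n$ for every $n\in\mathbb{Z}$.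
   Context: A power series $F(z)\in\mathbb{C}[[z]]$ is a $k$-Mahler function ($k\geqslant 2$ an integer) if there are an integer $d\geqslant 1$ and polynomials $a_0(z),\ldots,a_d(z)\in\mathbb{C}[z]$, with $a_d(z)$ not the zero polynomial, such that $\sum_{i=0}^d a_i(z)F(z^{k^i})=0$. "Converging inside the unit disc" means the power series converges for $|z|<1$. The polynomial $p_F$ is called the characteristic polynomial of $F$ (with respect to the given functional equation). The eigenvalue of $F(z)$ is the nonzero root $\lambda_F\in\mathbb{C}$ of $p_F$ for which, as $z\to1^-$ along the real interval $(0,1)$, $$F(z)=\frac{C(z)}{(1-z)^{\log_k\lambda_F}}(1+o(1)),$$ where $\log_k$ is the principal value of the base-$k$ logarithm, $(1-z)^{\log_k\lambda_F}=\exp(\log_k(\lambda_F)\ln(1-z))$, and $C(z)$ is a (complex-valued) real-analytic function on $(0,1)$ with $|C(z)|$ bounded away from $0$ and $\infty$ on $(0,1)$ and $C(z)=C(z^k)$ for $z\in(0,1)$. *)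

theory Defs
  imports "HOL-Analysis.Analysis" "HOL-Computational_Algebra.Computational_Algebra"
    "HOL-Library.Landau_Symbols"
begin

definition mahler_equation ::
    "nat \<Rightarrow> nat \<Rightarrow> (nat \<Rightarrow> complex poly) \<Rightarrow> complex fps \<Rightarrow> bool" where
  "mahler_equation k d a F \<longleftrightarrow>
     (\<Sum>i\<le>d. fps_of_poly (a i) * fps_compose F (fps_X ^ (k ^ i))) = 0"

definition mahler_function :: "nat \<Rightarrow> complex fps \<Rightarrow> bool" where
  "mahler_function k F \<longleftrightarrow>
     k \<ge> 2 \<and> (\<exists>d\<ge>1. \<exists>a. a d \<noteq> 0 \<and> mahler_equation k d a F)"

definition mahler_char_poly :: "nat \<Rightarrow> (nat \<Rightarrow> complex poly) \<Rightarrow> complex poly" where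
  "mahler_char_poly d a = (\<Sum>i\<le>d. monom (poly (a i) 1) (d - i))"

definition clog :: "nat \<Rightarrow> complex \<Rightarrow> complex" where
  "clog k w = Ln w / of_real (ln (real k))"

definition real_analytic_on :: "(real \<Rightarrow> complex) \<Rightarrow> real set \<Rightarrow> bool"
    (infixl \<open>real'_analytic'_on\<close> 50) where
  "f real_analytic_on S \<longleftrightarrow>
     (\<forall>x0\<in>S. \<exists>r>0. \<exists>c :: nat \<Rightarrow> complex. \<forall>x. \<bar>x - x0\<bar> < r \<longrightarrow>
        (\<lambda>n. c n * of_real ((x - x0) ^ n)) sums f x)"

(* The eigenvalue is unique when it exists: if two numbers satisfy this predicate, replacing x by
   x^k in the two asymptotic formulas shows that their quotient is 1. *)
definition mahler_eigenvalue ::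
    "nat \<Rightarrow> nat \<Rightarrow> (nat \<Rightarrow> complex poly) \<Rightarrow> complex fps \<Rightarrow> complex \<Rightarrow> bool" where
  "mahler_eigenvalue k d a F l \<longleftrightarrow>
     l \<noteq> 0 \<and> poly (mahler_char_poly d a) l = 0 \<and>
     (\<exists>C :: real \<Rightarrow> complex.
        C real_analytic_on {0<..<1} \<and>
        (\<exists>m>0. \<exists>M. \<forall>x\<in>{0<..<1}. m \<le> norm (C x) \<and> norm (C x) \<le> M) \<and>
        (\<forall>x\<in>{0<..<1}. C x = C (x ^ k)) \<and>
        (\<exists>h \<in> o[at_left 1](\<lambda>_. 1). \<forall>\<^sub>F x in at_left 1.
           eval_fps F (of_real x) =
             C x / exp (clog k l * of_real (ln (1 - x))) * (1 + h x)))"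

text \<open>The field of rational functions \<open>\<complex>(z)\<close>, inside the field of formal Laurent series.\<close>

definition rat_funs :: "complex fls set" where
  "rat_funs = {fps_to_fls (fps_of_poly p) / fps_to_fls (fps_of_poly q) | p q. q \<noteq> 0}"

definition transcendental_over :: "'a :: field set \<Rightarrow> 'a \<Rightarrow> bool" where
  "transcendental_over K x \<longleftrightarrow>
     (\<forall>P. P \<noteq> 0 \<and> (\<forall>i. coeff P i \<in> K) \<longrightarrow> poly P x \<noteq> 0)"

end

theory Submission
  imports Defs "HOL-Complex_Analysis.Complex_Analysis"
begin

text \<open>
  Suppose \<open>F\<close> is algebraic over \<open>\<complex>(z)\<close>, and let \<open>f\<close> be its sum on the unit disc. Each of the two
  alternative hypotheses is contradicted as soon as \<open>f(z) \<sim> c (1 - z)\<^sup>n\<close> at \<open>1\<close> with \<open>c \<noteq> 0\<close> and \<open>n\<close> an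
  \<^emph>\<open>integer\<close>. Indeed \<open>f(z\<^sup>q) \<sim> c q\<^sup>n (1 - z)\<^sup>n\<close>, so dividing the Mahler equation by
  \<open>(1 - z)\<^sup>n\<close> shows that \<open>k\<close> to the power \<open>-n\<close> is a root of the characteristic polynomial
  (\<open>char_poly_powi_eq_0\<close>), and comparing the quotient \<open>f(z\<^sup>k) / f(z)\<close> with its limit \<open>1 / \<lambda>\<close>
  computed from the eigenvalue asymptotics shows \<open>\<lambda>\<close> to be that same power
  (\<open>eigenvalue_eq_powi\<close>).

  An algebraic function has a priori only a Puiseux expansion at \<open>1\<close>, with a fractional exponent
  \<open>n\<close>, so the point is that \<open>f\<close> extends meromorphically across \<open>1\<close>. An algebraic
  function continues analytically across all but finitely many points of the unit circle
  (\<open>algebraic_analytic_continuation\<close>), hence across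
  \<open>\<zeta>\<^sub>M = exp (2 \<pi> i / k\<^sup>M)\<close> for all large \<open>M\<close>. The Mahler equation, solved for its last term, writes
  \<open>f\<close> at \<open>z\<close> raised to the power \<open>k\<^sup>d\<close> as a rational combination of the values of \<open>f\<close> at the
  lower powers; near
  \<open>z = \<zeta>\<^bsub>M+d\<^esub>\<close> it therefore yields a meromorphic extension at \<open>\<zeta>\<^sub>M\<close> from extensions at
  \<open>\<zeta>\<^bsub>M+1\<^esub>, \<dots>, \<zeta>\<^bsub>M+d\<^esub>\<close> (\<open>meromorphic_ext_mahler_step\<close>). Descending to \<open>\<zeta>\<^sub>0 = 1\<close> gives the claim
  (\<open>meromorphic_ext_at_1\<close>).
\<close>

section \<open>Bivariate polynomials and algebraic relations\<close>

text \<open>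
  The outer variable of the polynomial is \<open>y\<close>. Evaluating at the constant polynomial \<open>[:y:]\<close>
  first makes the map a composition of two ring homomorphisms.
\<close>

definition eval2 :: "complex poly poly \<Rightarrow> complex \<Rightarrow> complex \<Rightarrow> complex" where
  "eval2 p z y = poly (poly p [:y:]) z"

lemma eval2_simps [simp]:
  "eval2 0 z y = 0"
  "eval2 (pCons c p) z y = poly c z + y * eval2 p z y"
  "eval2 (p + q) z y = eval2 p z y + eval2 q z y"
  "eval2 (p * q) z y = eval2 p z y * eval2 q z y"
  "eval2 (smult c p) z y = poly c z * eval2 p z y"
  by (simp_all add: eval2_def)

lemma eval2_sum: "eval2 (sum p A) z y = (\<Sum>i\<in>A. eval2 (p i) z y)"
  by (simp add: eval2_def poly_sum)

lemma eval2_monom: "eval2 (monom c n) z y = poly c z * y ^ n"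
  by (simp add: eval2_def poly_monom)

lemma eval2_altdef: "eval2 p z y = (\<Sum>i\<le>degree p. poly (coeff p i) z * y ^ i)"
  by (simp add: eval2_def poly_altdef[of p] poly_sum)

lemma tendsto_eval2 [tendsto_intros]:
  assumes "(u \<longlongrightarrow> z) F" "(v \<longlongrightarrow> y) F"
  shows "((\<lambda>x. eval2 p (u x) (v x)) \<longlongrightarrow> eval2 p z y) F"
  by (induction p) (use assms in \<open>auto intro!: tendsto_intros\<close>)

lemma holomorphic_on_eval2 [holomorphic_intros]:
  assumes "u holomorphic_on A" "v holomorphic_on A"
  shows "(\<lambda>x. eval2 p (u x) (v x)) holomorphic_on A"
  by (induction p) (use assms in \<open>auto intro!: holomorphic_intros\<close>)

lemma has_field_derivative_eval2:
  "((\<lambda>y. eval2 p z y) has_field_derivative eval2 (pderiv p) z y) (at y within A)"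
proof (induction p)
  case (pCons c p)
  show ?case using pCons(2)
    by (auto intro!: derivative_eq_intros simp: pderiv_pCons)
qed auto

lemma holomorphic_mult_eq_0:
  assumes "u holomorphic_on ball c r" "v holomorphic_on ball c r"
  assumes "\<And>z. z \<in> ball c r \<Longrightarrow> u z * v z = (0::complex)"
  assumes "z0 \<in> ball c r" "u z0 \<noteq> 0" "z \<in> ball c r"
  shows "v z = 0"
proof -
  have "open (ball c r \<inter> u -` (-{0}))"
    using assms(1) by (intro continuous_open_preimage holomorphic_on_imp_continuous_on) auto
  moreover have "v w = 0" if "w \<in> ball c r \<inter> u -` (-{0})" for w
    using assms(3)[of w] that by auto
  ultimately show ?thesis
    using analytic_continuation_open[of "ball c r \<inter> u -` (-{0})" "ball c r" v "\<lambda>_. 0" z]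
      assms IntI[of z0 "ball c r" "u -` (-{0})"]
    by fastforce
qed

text \<open>
  This is the form in which separability is used: it bounds \<open>\<partial>p/\<partial>y\<close> away from zero along the graph
  of \<open>f\<close> near points where \<open>R\<close> does not vanish and \<open>f\<close> stays bounded. Take \<open>p\<close> of minimal degree in \<open>y\<close>
  and a nonzero \<open>G\<close> of minimal degree in the ideal generated by \<open>p\<close> and \<open>\<partial>p/\<partial>y\<close>. By
  pseudo-division, \<open>G\<close> divides a multiple of \<open>p\<close> by a polynomial in \<open>z\<close>. If \<open>G\<close> had positive
  degree in \<open>y\<close>, then \<open>G\<close> or its cofactor would annihilate \<open>f\<close> in lower degree than \<open>p\<close>. So
  \<open>G = R(z)\<close>, and evaluating its representation at \<open>f\<close> gives the identity.
\<close>

lemma ex_separable_annihilator: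
  assumes f: "f holomorphic_on ball 0 1"
    and p0: "p0 \<noteq> 0" "\<And>z. z \<in> ball 0 1 \<Longrightarrow> eval2 p0 z (f z) = 0"
  obtains p b R where "p \<noteq> 0" "\<And>z. z \<in> ball 0 1 \<Longrightarrow> eval2 p z (f z) = 0" "R \<noteq> 0"
    "\<And>z. z \<in> ball 0 1 \<Longrightarrow> eval2 b z (f z) * eval2 (pderiv p) z (f z) = poly R z"
proof -
  define ann where "ann p \<longleftrightarrow> (\<forall>z\<in>ball 0 1. eval2 p z (f z) = 0)" for p
  obtain p where p: "p \<noteq> 0" "ann p" 
    and pmin: "\<And>q. q \<noteq> 0 \<Longrightarrow> ann q \<Longrightarrow> degree p \<le> degree q"
    using exists_least_iff[of "\<lambda>n. \<exists>p. p \<noteq> 0 \<and> ann p \<and> degree p = n"] p0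
    by (metis ann_def not_le)
  have "degree p \<noteq> 0"
  proof
    assume "degree p = 0"
    then obtain c where c: "p = [:c:]" by (meson degree_eq_zeroE)
    have "poly c z = 0" if "z \<in> ball 0 1" for z
      using p(2) that by (auto simp: ann_def c)
    hence "ball 0 1 \<subseteq> {z. poly c z = 0}" by blast
    moreover have "infinite (ball (0::complex) 1)"
      using uncountable_ball[of 1 "0::complex"] countable_finite by auto
    ultimately have "c = 0" using poly_roots_finite[of c] finite_subset by metis
    with p(1) c show False by simp
  qed
  hence dp: "pderiv p \<noteq> 0" "degree (pderiv p) < degree p"
    by (auto simp: pderiv_eq_0_iff degree_pderiv)
  define I where "I = {G. G \<noteq> 0 \<and> (\<exists>a b. G = a * p + b * pderiv p)}"
  have "pderiv p \<in> I"
  proof -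
    have "pderiv p = 0 * p + 1 * pderiv p" by simp
    thus ?thesis using dp(1) unfolding I_def by blast
  qed
  then obtain G where G: "G \<in> I" and Gmin: "\<And>q. q \<in> I \<Longrightarrow> degree G \<le> degree q"
    using exists_least_iff[of "\<lambda>n. \<exists>p. p \<in> I \<and> degree p = n"] by (metis not_le)
  from G obtain a b where ab: "G \<noteq> 0" "G = a * p + b * pderiv p" by (auto simp: I_def)
  have dG: "degree G < degree p" using Gmin[OF \<open>pderiv p \<in> I\<close>] dp by simp
  have "degree G = 0"
  proof (rule ccontr)
    assume nz: "degree G \<noteq> 0"
    obtain s S where s: "s \<noteq> 0" "smult s p = G * S + pseudo_mod p G"
      using pseudo_mod(1)[OF ab(1), of p] by blast
    have "pseudo_mod p G = ([:s:] - a * S) * p + (- (b * S)) * pderiv p"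
      using s(2) by (simp add: ab(2) algebra_simps)
    hence "pseudo_mod p G \<in> I" if "pseudo_mod p G \<noteq> 0"
      using that unfolding I_def by blast
    hence r: "pseudo_mod p G = 0"
      using pseudo_mod(2)[OF ab(1), of p] Gmin by fastforce
    hence sp: "smult s p = G * S" using s by simp
    hence S: "S \<noteq> 0" using s p(1) by auto
    have "degree p = degree G + degree S"
      using sp s(1) ab(1) S by (metis degree_mult_eq degree_smult_eq)
    hence "\<not> ann S" "\<not> ann G" using pmin[of S] pmin[of G] S ab(1) nz dG by auto
    then obtain z0 z1 where z: "z0 \<in> ball 0 1" "z1 \<in> ball 0 1" "eval2 G z0 (f z0) \<noteq> 0" "eval2 S z1 (f z1) \<noteq> 0"
      by (auto simp: ann_def)
    have "eval2 G z (f z) * eval2 S z (f z) = 0" if "z \<in> ball 0 1" for z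
      using that p(2) sp by (metis ann_def eval2_simps(4,5) mult_zero_right)
    moreover have "(\<lambda>z. eval2 G z (f z)) holomorphic_on ball 0 1" "(\<lambda>z. eval2 S z (f z)) holomorphic_on ball 0 1"
      by (intro holomorphic_intros f)+
    ultimately show False
      using holomorphic_mult_eq_0[of "\<lambda>z. eval2 G z (f z)" 0 1 "\<lambda>z. eval2 S z (f z)" z0 z1] z by blast
  qed
  then obtain R where R: "G = [:R:]" by (meson degree_eq_zeroE)
  show ?thesis
  proof (rule that[of p R b])
    fix z :: complex assume "z \<in> ball 0 1"
    hence "eval2 p z (f z) = 0" using p(2) by (auto simp: ann_def)
    moreover have "eval2 G z (f z) = poly R z" by (simp add: R)
    ultimately show "eval2 b z (f z) * eval2 (pderiv p) z (f z) = poly R z"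
      unfolding ab(2) by simp
  qed (use p ab R in \<open>auto simp: ann_def\<close>)
qed

text \<open>
  Cauchy's bound for roots, multiplied out so that the leading coefficient may vanish.
\<close>

lemma eval2_root_bound:
  assumes "eval2 p z y = 0"
  shows "norm (poly (lead_coeff p) z) * norm y \<le>
    norm (poly (lead_coeff p) z) + (\<Sum>i<degree p. norm (poly (coeff p i) z))"
proof (cases "norm y \<le> 1")
  case True
  have "norm (poly (lead_coeff p) z) * norm y \<le> norm (poly (lead_coeff p) z) * 1"
    by (intro mult_left_mono True) auto
  moreover have "0 \<le> (\<Sum>i<degree p. norm (poly (coeff p i) z))" by (intro sum_nonneg) auto
  ultimately show ?thesis by linarith
next
  case False
  have eq: "poly (lead_coeff p) z * y ^ degree p = - (\<Sum>i<degree p. poly (coeff p i) z * y ^ i)"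
    using assms unfolding eval2_altdef
    by (simp add: lessThan_Suc_atMost[symmetric] eq_neg_iff_add_eq_0 add.commute)
  show ?thesis
  proof (cases "degree p")
    case 0
    thus ?thesis using eq by simp
  next
    case (Suc m)
    have "norm (poly (lead_coeff p) z) * norm y * norm y ^ m = norm (poly (lead_coeff p) z * y ^ degree p)"
      by (simp add: Suc norm_mult norm_power)
    also have "\<dots> \<le> (\<Sum>i<degree p. norm (poly (coeff p i) z * y ^ i))"
      unfolding eq norm_minus_cancel by (rule norm_sum)
    also have "\<dots> \<le> (\<Sum>i<degree p. norm (poly (coeff p i) z) * norm y ^ m)"
      using False Suc
      by (intro sum_mono) (auto simp: norm_mult norm_power intro!: mult_left_mono power_increasing)
    also have "\<dots> = (\<Sum>i<degree p. norm (poly (coeff p i) z)) * norm y ^ m"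
      by (simp add: sum_distrib_right)
    finally have "norm (poly (lead_coeff p) z) * norm y \<le> (\<Sum>i<degree p. norm (poly (coeff p i) z))"
      by (rule mult_right_le_imp_le) (rule zero_less_power, use False in linarith)
    thus ?thesis by (simp add: add_increasing)
  qed
qed

text \<open>
  The holomorphic implicit function theorem near a simple root, with uniqueness of the root. The
  simplified Newton maps \<open>T z\<close>, with derivative frozen at \<open>(\<zeta>, y0)\<close>, are contractions of one fixed
  disc for all \<open>z\<close> near \<open>\<zeta>\<close>. Their iterates started at \<open>y0\<close> are polynomial in \<open>z\<close> and converge
  uniformly, so the fixed point depends holomorphically on \<open>z\<close>.
\<close>

lemma eval2_implicit:
  assumes "eval2 p \<zeta> y0 = 0" "eval2 (pderiv p) \<zeta> y0 \<noteq> 0"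
  obtains r s g where "r > 0" "s > 0" "g holomorphic_on ball \<zeta> r"
    "\<And>z y. z \<in> ball \<zeta> r \<Longrightarrow> y \<in> ball y0 s \<Longrightarrow> eval2 p z y = 0 \<Longrightarrow> y = g z"
proof -
  define c where "c = eval2 (pderiv p) \<zeta> y0"
  have c: "c \<noteq> 0" using assms by (simp add: c_def)
  define T where "T z y = y - eval2 p z y / c" for z y
  define T' where "T' z y = 1 - eval2 (pderiv p) z y / c" for z y
  have T': "(T z has_field_derivative T' z y) (at y within A)" for z y A
    unfolding T_def T'_def using c
    by (auto intro!: derivative_eq_intros has_field_derivative_eval2)
  have "((\<lambda>x. T' (fst x) (snd x)) \<longlongrightarrow> T' (fst (\<zeta>, y0)) (snd (\<zeta>, y0))) (nhds (\<zeta>, y0))"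
    unfolding T'_def by (intro tendsto_intros c filterlim_ident)
  moreover have "T' (fst (\<zeta>, y0)) (snd (\<zeta>, y0)) = 0"
    using c by (simp add: T'_def c_def)
  ultimately have "eventually (\<lambda>x. norm (T' (fst x) (snd x)) < 1/2) (nhds (\<zeta>, y0))"
    by (auto dest: tendstoD[of _ _ _ "1/2"])
  then obtain e where e: "e > 0" "\<And>z y. dist (z,y) (\<zeta>,y0) < e \<Longrightarrow> norm (T' z y) < 1/2"
    by (fastforce simp: eventually_nhds_metric)
  define s where "s = e / 3"
  have s: "s > 0" using e by (simp add: s_def)
  \<comment> \<open>A third of \<open>e\<close> in each coordinate keeps the pair \<open>(z, y)\<close> within distance \<open>e\<close>.\<close>
  have T'_le: "norm (T' z y) \<le> 1/2" if "z \<in> cball \<zeta> s" "y \<in> cball y0 s" for z y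
  proof -
    have "dist (z,y) (\<zeta>,y0) \<le> dist z \<zeta> + dist y y0"
      by (simp add: dist_Pair_Pair sqrt_sum_squares_le_sum)
    also have "\<dots> < e" using that e by (simp add: s_def dist_commute)
    finally show ?thesis using e(2)[of z y] by simp
  qed
  have "((\<lambda>z. eval2 p z y0 / c) \<longlongrightarrow> eval2 p \<zeta> y0 / c) (nhds \<zeta>)"
    by (intro tendsto_intros c filterlim_ident)
  hence "eventually (\<lambda>z. norm (eval2 p z y0 / c) < s / 2) (nhds \<zeta>)"
    using s assms(1) by (auto dest: tendstoD[of _ _ _ "s/2"])
  then obtain t where t: "t > 0" "\<And>z. dist z \<zeta> < t \<Longrightarrow> norm (eval2 p z y0 / c) < s / 2"
    by (auto simp: eventually_nhds_metric)
  define r where "r = min s (t / 2)"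
  have r: "r > 0" using s t by (simp add: r_def)
  have r_le: "z \<in> cball \<zeta> s" "norm (eval2 p z y0 / c) \<le> s / 2" if "z \<in> cball \<zeta> r" for z
    using that t(1) t(2)[of z] by (auto simp: r_def dist_commute)
  have lip: "dist (T z x) (T z y) \<le> 1/2 * dist x y"
    if "z \<in> cball \<zeta> r" "x \<in> cball y0 s" "y \<in> cball y0 s" for z x y
    unfolding dist_norm
    by (rule field_differentiable_bound[of "cball y0 s" "T z" "T' z"])
       (use that T' T'_le r_le in auto)
  have self: "T z ` cball y0 s \<subseteq> cball y0 s" if "z \<in> cball \<zeta> r" for z
  proof safe
    fix y assume y: "y \<in> cball y0 s"
    have "dist y0 (T z y) \<le> dist y0 (T z y0) + dist (T z y0) (T z y)" by (rule dist_triangle)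
    also have "dist y0 (T z y0) \<le> s / 2" using r_le(2)[OF that] by (simp add: T_def dist_norm)
    also have "dist (T z y0) (T z y) \<le> 1/2 * dist y0 y" using lip[OF that _ y] s by simp
    also have "\<dots> \<le> s / 2" using y by simp
    finally show "T z y \<in> cball y0 s" by simp
  qed
  have "\<exists>!y\<in>cball y0 s. T z y = y" if "z \<in> cball \<zeta> r" for z
    by (rule Banach_fix[of _ "1/2"]) (use self lip that s in \<open>auto simp: complete_eq_closed\<close>)
  hence "\<exists>y\<in>cball y0 s. T z y = y" if "z \<in> cball \<zeta> r" for z
    using that by blast
  then obtain g where g: "\<And>z. z \<in> cball \<zeta> r \<Longrightarrow> g z \<in> cball y0 s"
      "\<And>z. z \<in> cball \<zeta> r \<Longrightarrow> T z (g z) = g z"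
    by metis
  define u where "u n z = (T z ^^ n) y0" for n z
  have u: "u 0 z = y0" "u (Suc n) z = T z (u n z)" for n z
    by (simp_all add: u_def)
  have u_hol: "u n holomorphic_on A" for n A
  proof (induction n)
    case (Suc n)
    thus ?case unfolding u(2) T_def using c by (auto intro!: holomorphic_intros)
  qed (simp add: u)
  have u_bd: "u n z \<in> cball y0 s \<and> dist (u n z) (g z) \<le> (1/2) ^ n * s" if "z \<in> cball \<zeta> r" for n z
  proof (induction n)
    case 0
    thus ?case using s g(1)[OF that] by (simp add: u)
  next
    case (Suc n)
    have "dist (T z (u n z)) (T z (g z)) \<le> 1/2 * dist (u n z) (g z)"
      using lip[OF that] Suc g(1)[OF that] by blast
    also have "\<dots> \<le> 1/2 * ((1/2) ^ n * s)" using Suc by (intro mult_left_mono) auto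
    finally have "dist (u (Suc n) z) (g z) \<le> (1/2) ^ Suc n * s"
      using g(2)[OF that] by (simp add: u)
    moreover have "u (Suc n) z \<in> cball y0 s"
      unfolding u(2) by (rule subsetD[OF self[OF that]], rule imageI) (use Suc in simp)
    ultimately show ?case by blast
  qed
  have ul: "uniform_limit (cball \<zeta> r) u g sequentially"
  proof (rule uniform_limitI)
    fix e :: real assume "e > 0"
    have "(\<lambda>n. (1/2) ^ n * s) \<longlonglongrightarrow> 0 * s"
      by (intro tendsto_intros LIMSEQ_realpow_zero) auto
    hence "eventually (\<lambda>n. (1/2) ^ n * s < e) sequentially"
      using \<open>e > 0\<close> by (auto dest: order_tendstoD)
    thus "\<forall>\<^sub>F n in sequentially. \<forall>x\<in>cball \<zeta> r. dist (u n x) (g x) < e"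
    proof eventually_elim
      case (elim n)
      show ?case using le_less_trans[OF conjunct2[OF u_bd] elim] by blast
    qed
  qed
  have g_hol: "g holomorphic_on ball \<zeta> r"
    by (rule holomorphic_uniform_limit[OF _ ul])
       (auto intro!: always_eventually u_hol holomorphic_on_imp_continuous_on)
  show ?thesis
  proof (rule that[OF r s g_hol])
    fix z y assume zy: "z \<in> ball \<zeta> r" "y \<in> ball y0 s" "eval2 p z y = 0"
    have "T z y = y" using zy by (simp add: T_def)
    hence "dist y (g z) \<le> 1/2 * dist y (g z)"
      using lip[of z y "g z"] g[of z] zy by (simp del: dist_le_zero_iff)
    thus "y = g z" by simp
  qed
qed

text \<open>
  Along a radius to \<open>\<zeta>\<close> the values of \<open>f\<close> stay bounded because the leading coefficient of \<open>p\<close> does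
  not vanish at \<open>\<zeta>\<close>; hence they accumulate at some \<open>y0\<close>, which is a simple root of \<open>p\<close> over \<open>\<zeta>\<close>
  since \<open>R(\<zeta>) \<noteq> 0\<close>. The implicit function through \<open>(\<zeta>, y0)\<close> agrees with \<open>f\<close> near one point of the
  radius, and so on the whole convex set where both are defined.
\<close>

lemma algebraic_analytic_continuation:
  assumes f: "f holomorphic_on ball 0 1"
    and p: "\<And>z. z \<in> ball 0 1 \<Longrightarrow> eval2 p z (f z) = 0"
    and R: "\<And>z. z \<in> ball 0 1 \<Longrightarrow> eval2 b z (f z) * eval2 (pderiv p) z (f z) = poly R z"
    and \<zeta>: "norm \<zeta> = 1" "poly R \<zeta> \<noteq> 0" "poly (lead_coeff p) \<zeta> \<noteq> 0"
  obtains g where "g analytic_on {\<zeta>}" "eventually (\<lambda>z. f z = g z) (at \<zeta> within ball 0 1)"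
proof -
  define x where "x n = \<zeta> * (1 - of_real (inverse (real (Suc n))))" for n
  have x_lim: "x \<longlonglongrightarrow> \<zeta>"
  proof -
    have "x \<longlonglongrightarrow> \<zeta> * (1 - of_real 0)"
      unfolding x_def by (intro tendsto_intros LIMSEQ_inverse_real_of_nat)
    thus ?thesis by simp
  qed
  have x_in: "x n \<in> ball 0 1" for n
  proof -
    have "x n = \<zeta> * of_real (1 - inverse (real (Suc n)))" by (simp add: x_def)
    hence "norm (x n) = \<bar>1 - inverse (real (Suc n))\<bar>"
      using \<zeta> by (simp add: norm_mult del: of_real_diff)
    also have "\<dots> < 1" by (simp add: abs_if field_simps)
    finally show ?thesis by simp
  qed
  define l where "l z = norm (poly (lead_coeff p) z)" for z
  define B where "B z = (l z + (\<Sum>i<degree p. norm (poly (coeff p i) z))) / l z" for z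
  have l\<zeta>: "l \<zeta> \<noteq> 0" using \<zeta> by (simp add: l_def)
  have "(\<lambda>n. l (x n)) \<longlonglongrightarrow> l \<zeta>" unfolding l_def by (intro tendsto_intros x_lim)
  moreover have "l \<zeta> > 0" using l\<zeta> by (simp add: l_def)
  ultimately have ev_l: "eventually (\<lambda>n. l (x n) > 0) sequentially"
    by (rule order_tendstoD)
  have "(\<lambda>n. B (x n)) \<longlonglongrightarrow> B \<zeta>" unfolding B_def l_def
    using l\<zeta> by (intro tendsto_intros x_lim) (auto simp: l_def)
  hence "eventually (\<lambda>n. B (x n) < B \<zeta> + 1) sequentially" by (rule order_tendstoD) auto
  with ev_l have "eventually (\<lambda>n. norm (f (x n)) \<le> B \<zeta> + 1) sequentially"
  proof eventually_elim
    case (elim n)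
    have "l (x n) * norm (f (x n)) \<le> l (x n) + (\<Sum>i<degree p. norm (poly (coeff p i) (x n)))"
      using eval2_root_bound[OF p[OF x_in[of n]]] by (simp add: l_def)
    hence "norm (f (x n)) \<le> B (x n)" using elim by (simp add: B_def field_simps)
    thus ?case using elim by simp
  qed
  then obtain N where N: "\<And>n. n \<ge> N \<Longrightarrow> norm (f (x n)) \<le> B \<zeta> + 1"
    by (auto simp: eventually_sequentially)
  have "bounded (range (\<lambda>n. f (x (n + N))))"
    by (rule boundedI[of _ "B \<zeta> + 1"]) (use N in auto)
  then obtain y0 \<sigma> where \<sigma>: "strict_mono \<sigma>" "((\<lambda>n. f (x (n + N))) \<circ> \<sigma>) \<longlonglongrightarrow> y0"
    using bounded_imp_convergent_subsequence by blast
  define w where "w n = x (\<sigma> n + N)" for n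
  have w_in: "w n \<in> ball 0 1" for n using x_in unfolding w_def by blast
  have w_lim: "w \<longlonglongrightarrow> \<zeta>"
    using LIMSEQ_subseq_LIMSEQ[OF LIMSEQ_ignore_initial_segment[OF x_lim, of N] \<sigma>(1)]
    by (simp add: w_def[abs_def] o_def)
  have fw_lim: "(\<lambda>n. f (w n)) \<longlonglongrightarrow> y0" using \<sigma>(2) by (simp add: o_def w_def)
  have "(\<lambda>n. eval2 p (w n) (f (w n))) \<longlonglongrightarrow> eval2 p \<zeta> y0"
    by (intro tendsto_intros w_lim fw_lim)
  hence y0: "eval2 p \<zeta> y0 = 0" using p[OF w_in] by (simp add: LIMSEQ_const_iff)
  have "(\<lambda>n. eval2 b (w n) (f (w n)) * eval2 (pderiv p) (w n) (f (w n)))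
      \<longlonglongrightarrow> eval2 b \<zeta> y0 * eval2 (pderiv p) \<zeta> y0"
    by (intro tendsto_intros w_lim fw_lim)
  moreover have "(\<lambda>n. poly R (w n)) \<longlonglongrightarrow> poly R \<zeta>" by (intro tendsto_intros w_lim)
  ultimately have "eval2 b \<zeta> y0 * eval2 (pderiv p) \<zeta> y0 = poly R \<zeta>"
    using R[OF w_in] by (metis (mono_tags, lifting) LIMSEQ_unique tendsto_cong always_eventually)
  hence y0': "eval2 (pderiv p) \<zeta> y0 \<noteq> 0" using \<zeta> by auto
  obtain r s g where g: "r > 0" "s > 0" "g holomorphic_on ball \<zeta> r"
    "\<And>z y. z \<in> ball \<zeta> r \<Longrightarrow> y \<in> ball y0 s \<Longrightarrow> eval2 p z y = 0 \<Longrightarrow> y = g z"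
    using eval2_implicit[OF y0 y0'] by metis
  have "eventually (\<lambda>n. w n \<in> ball \<zeta> r \<and> f (w n) \<in> ball y0 s) sequentially"
    using g by (intro eventually_conj topological_tendstoD[OF w_lim] topological_tendstoD[OF fw_lim]) auto
  then obtain n where n: "w n \<in> ball \<zeta> r" "f (w n) \<in> ball y0 s"
    by (auto simp: eventually_sequentially)
  define U where "U = ball \<zeta> r \<inter> (ball 0 1 \<inter> f -` ball y0 s)"
  have U: "open U" unfolding U_def
    by (intro open_Int continuous_open_preimage holomorphic_on_imp_continuous_on f) auto
  have "w n \<in> U" using n w_in by (auto simp: U_def)
  have eq: "f z = g z" if "z \<in> ball \<zeta> r \<inter> ball 0 1" for z
  proof (rule analytic_continuation_open[of U "ball \<zeta> r \<inter> ball 0 1" f g])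
    show "connected (ball \<zeta> r \<inter> ball 0 1)"
      by (intro convex_connected convex_Int) auto
    show "f z = g z" if "z \<in> U" for z
      using that g(4)[of z "f z"] p[of z] by (auto simp: U_def)
  qed (use that U \<open>w n \<in> U\<close> f g(3) in \<open>auto simp: U_def intro: holomorphic_on_subset\<close>)
  show ?thesis
  proof (rule that[of g])
    show "g analytic_on {\<zeta>}" using g by (auto simp: analytic_at intro!: exI[of _ "ball \<zeta> r"])
    show "eventually (\<lambda>z. f z = g z) (at \<zeta> within ball 0 1)"
      unfolding eventually_at using g(1) eq by (auto simp: dist_commute)
  qed
qed

section \<open>Passing from power series to functions on the disc\<close>

lemma has_fps_expansion_unit_disc:
  fixes F :: "complex fps"
  assumes "fps_conv_radius F \<ge> 1"
  shows "eval_fps F has_fps_expansion F"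
  by (rule eval_fps_has_fps_expansion) (rule less_le_trans[OF _ assms], simp)

lemma holomorphic_on_eval_fps_unit_disc:
  assumes "fps_conv_radius F \<ge> 1"
  shows "eval_fps F holomorphic_on ball 0 1"
proof (rule holomorphic_on_eval_fps, rule subsetI)
  fix z :: complex assume "z \<in> ball 0 1"
  hence "ereal (norm z) < 1" by simp
  also note assms
  finally show "z \<in> eball 0 (fps_conv_radius F)" by (simp add: in_eball_iff)
qed

lemma has_fps_expansion_poly: "poly p has_fps_expansion fps_of_poly p" for p :: "complex poly"
  using eval_fps_has_fps_expansion[of "fps_of_poly p"]
  by (simp add: eval_fps_of_poly[abs_def])

lemma algebraic_imp_eval2:
  assumes alg: "\<not> transcendental_over rat_funs (fps_to_fls F)" and F: "fps_conv_radius F \<ge> 1"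
  obtains p where "p \<noteq> 0" "\<And>z. z \<in> ball 0 1 \<Longrightarrow> eval2 p z (eval_fps F z) = 0"
proof -
  note F_exp = has_fps_expansion_unit_disc[OF F] and F_hol = holomorphic_on_eval_fps_unit_disc[OF F]
  define \<phi> where "\<phi> p = fps_to_fls (fps_of_poly p)" for p :: "complex poly"
  have \<phi>_mult: "\<phi> (p * q) = \<phi> p * \<phi> q" for p q
    by (simp add: \<phi>_def fps_of_poly_mult fls_times_fps_to_fls)
  have \<phi>_0: "\<phi> p = 0 \<longleftrightarrow> p = 0" for p
    by (simp add: \<phi>_def)
  obtain P where P: "P \<noteq> 0" "\<And>i. coeff P i \<in> rat_funs" "poly P (fps_to_fls F) = 0"
    using alg by (auto simp: transcendental_over_def)
  have "\<exists>u v. v \<noteq> 0 \<and> coeff P i = \<phi> u / \<phi> v" for i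
    using P(2)[of i] by (auto simp: rat_funs_def \<phi>_def)
  then obtain u v where uv: "\<And>i. v i \<noteq> 0" "\<And>i. coeff P i = \<phi> (u i) / \<phi> (v i)"
    by metis
  define m where "m = degree P"
  \<comment> \<open>Clear denominators in the relation \<open>P(F) = 0\<close>.\<close>
  define c where "c i = u i * (\<Prod>j\<in>{..m} - {i}. v j)" for i
  define D where "D = (\<Prod>j\<le>m. v j)"
  have c: "\<phi> (c i) = \<phi> D * coeff P i" if "i \<le> m" for i
  proof -
    have "D = v i * (\<Prod>j\<in>{..m} - {i}. v j)"
      unfolding D_def using that by (intro prod.remove) auto
    thus ?thesis using uv(1)[of i] by (simp add: uv(2) c_def \<phi>_mult \<phi>_0)
  qed
  have "D \<noteq> 0" using uv(1) by (simp add: D_def)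
  have "fps_to_fls (\<Sum>i\<le>n. fps_of_poly (c i) * F ^ i) = (\<Sum>i\<le>n. \<phi> (c i) * fps_to_fls F ^ i)" for n
    by (induction n) (simp_all add: \<phi>_def fls_times_fps_to_fls fps_to_fls_power)
  hence "fps_to_fls (\<Sum>i\<le>m. fps_of_poly (c i) * F ^ i) = (\<Sum>i\<le>m. \<phi> (c i) * fps_to_fls F ^ i)" .
  also have "\<dots> = \<phi> D * poly P (fps_to_fls F)"
    by (simp add: poly_altdef m_def[symmetric] sum_distrib_left c mult.assoc)
  finally have sum_0: "(\<Sum>i\<le>m. fps_of_poly (c i) * F ^ i) = 0"
    using P(3) by simp
  have exp_0: "(\<lambda>z. \<Sum>i\<le>m. poly (c i) z * eval_fps F z ^ i) has_fps_expansion 0"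
    unfolding sum_0[symmetric] by (intro fps_expansion_intros F_exp has_fps_expansion_poly)
  define p where "p = (\<Sum>i\<le>m. monom (c i) i)"
  show ?thesis
  proof (rule that)
    have "coeff P m \<noteq> 0" using P(1) by (simp add: m_def)
    hence "c m \<noteq> 0" using c[of m] \<open>D \<noteq> 0\<close> \<phi>_0 by (metis mult_eq_0_iff order_refl)
    moreover have "coeff p m = c m" by (simp add: p_def coeff_sum)
    ultimately show "p \<noteq> 0" by auto
  next
    fix z :: complex assume "z \<in> ball 0 1"
    hence "(\<Sum>i\<le>m. poly (c i) z * eval_fps F z ^ i) = 0"
      by (intro has_fps_expansion_0_analytic_continuation[OF exp_0, of "ball 0 1"]
          holomorphic_intros F_hol) auto
    thus "eval2 p z (eval_fps F z) = 0"
      by (simp add: p_def eval2_sum eval2_monom)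
  qed
qed

lemma mahler_equation_eval:
  assumes eq: "mahler_equation k d a F" and F: "fps_conv_radius F \<ge> 1" and k: "k > 0"
    and z: "z \<in> ball 0 1"
  shows "(\<Sum>i\<le>d. poly (a i) z * eval_fps F (z ^ (k ^ i))) = 0"
proof -
  note F_exp = has_fps_expansion_unit_disc[OF F] and F_hol = holomorphic_on_eval_fps_unit_disc[OF F]
  have "(eval_fps F \<circ> (\<lambda>z. z ^ (k ^ i))) has_fps_expansion fps_compose F (fps_X ^ (k ^ i))" for i
    by (intro has_fps_expansion_compose F_exp fps_expansion_intros) (use k in simp)
  hence comp: "(\<lambda>z. eval_fps F (z ^ (k ^ i))) has_fps_expansion fps_compose F (fps_X ^ (k ^ i))" for i
    by (simp add: o_def)
  have exp_0: "(\<lambda>z. \<Sum>i\<le>d. poly (a i) z * eval_fps F (z ^ (k ^ i))) has_fps_expansion 0"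
    unfolding eq[unfolded mahler_equation_def, symmetric]
    by (intro fps_expansion_intros comp has_fps_expansion_poly)
  have "(\<lambda>z. eval_fps F (z ^ (k ^ i))) holomorphic_on ball 0 1" for i
    using k by (intro holomorphic_on_compose_gen[OF _ F_hol, unfolded o_def] holomorphic_intros)
      (auto simp: norm_power power_less_one_iff)
  thus ?thesis using z
    by (intro has_fps_expansion_0_analytic_continuation[OF exp_0, of "ball 0 1"] holomorphic_intros) auto
qed

section \<open>Meromorphic extension across a boundary point\<close>

definition meromorphic_ext :: "(complex \<Rightarrow> complex) \<Rightarrow> complex \<Rightarrow> bool" where
  "meromorphic_ext f \<zeta> \<longleftrightarrow>
     (\<exists>g. g meromorphic_on {\<zeta>} \<and> eventually (\<lambda>z. f z = g z) (at \<zeta> within ball 0 1))"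

lemma eventually_poly_nonzero:
  fixes p :: "complex poly"
  assumes "p \<noteq> 0"
  shows "eventually (\<lambda>z. poly p z \<noteq> 0) (at c within A)"
proof -
  have "\<not> c islimpt {z. poly p z = 0}"
    using poly_roots_finite[OF assms] by (rule islimpt_finite)
  hence "eventually (\<lambda>z. poly p z \<noteq> 0) (at c)"
    by (simp add: islimpt_iff_eventually)
  thus ?thesis by (rule filter_leD[OF at_le, rotated]) auto
qed

lemma meromorphic_ext_compose_power:
  assumes "meromorphic_ext f (\<xi> ^ q)" "norm \<xi> = 1" "q > 0"
  shows "meromorphic_ext (\<lambda>z. f (z ^ q)) \<xi>"
proof -
  obtain g where g: "g meromorphic_on {\<xi> ^ q}"
    "eventually (\<lambda>z. f z = g z) (at (\<xi> ^ q) within ball 0 1)"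
    using assms(1) by (auto simp: meromorphic_ext_def)
  have "(\<lambda>z. g (z ^ q)) meromorphic_on {\<xi>}"
    by (rule meromorphic_on_compose[OF g(1)]) (auto intro!: analytic_intros)
  moreover have "filterlim (\<lambda>z. z ^ q) (at (\<xi> ^ q) within ball 0 1) (at \<xi> within ball 0 1)"
    unfolding filterlim_at
  proof
    show "eventually (\<lambda>z. z ^ q \<in> ball 0 1 \<and> z ^ q \<noteq> \<xi> ^ q) (at \<xi> within ball 0 1)"
      unfolding eventually_at_filter
    proof (intro always_eventually allI impI)
      fix z :: complex assume "z \<in> ball 0 1"
      hence "norm (z ^ q) < 1" using assms(3) by (simp add: norm_power power_Suc_less_one power_less_one_iff)
      moreover have "norm (\<xi> ^ q) = 1" using assms(2) by (simp add: norm_power)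
      ultimately show "z ^ q \<in> ball 0 1 \<and> z ^ q \<noteq> \<xi> ^ q" by auto
    qed
  qed (auto intro!: tendsto_intros)
  ultimately show ?thesis
    using eventually_compose_filterlim[OF g(2)] unfolding meromorphic_ext_def by blast
qed

text \<open>
  Near \<open>\<xi>\<^sup>q\<close> the power map has a holomorphic inverse branch \<open>s\<close> with \<open>s(\<xi>\<^sup>q) = \<xi>\<close>. It maps nonzero
  points of the disc into the disc, as \<open>\<bar>s(w)\<bar>\<^sup>q = \<bar>w\<bar>\<close>.
\<close>

lemma meromorphic_ext_root:
  assumes "meromorphic_ext (\<lambda>z. f (z ^ q)) \<xi>" "norm \<xi> = 1" "q > 0"
  shows "meromorphic_ext f (\<xi> ^ q)"
proof -
  obtain g where g: "g meromorphic_on {\<xi>}"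
    "eventually (\<lambda>z. f (z ^ q) = g z) (at \<xi> within ball 0 1)"
    using assms(1) by (auto simp: meromorphic_ext_def)
  have \<xi>: "\<xi> \<noteq> 0" using assms(2) by auto
  define s where "s w = \<xi> * exp (Ln (w / \<xi> ^ q) / of_nat q)" for w
  have s_pow: "s w ^ q = w" if "w \<noteq> 0" for w
  proof -
    have "exp (Ln (w / \<xi> ^ q) / of_nat q) ^ q = exp (of_nat q * (Ln (w / \<xi> ^ q) / of_nat q))"
      by (rule exp_of_nat_mult[symmetric])
    also have "of_nat q * (Ln (w / \<xi> ^ q) / of_nat q) = Ln (w / \<xi> ^ q)"
      using assms(3) by simp
    also have "exp (Ln (w / \<xi> ^ q)) = w / \<xi> ^ q"
      using that \<xi> by (intro exp_Ln) auto
    finally show ?thesis using \<xi> by (simp add: s_def power_mult_distrib)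
  qed
  have s_at: "s (\<xi> ^ q) = \<xi>" using \<xi> by (simp add: s_def)
  have s_an: "s analytic_on {\<xi> ^ q}"
    unfolding s_def using \<xi> assms(3) by (auto intro!: analytic_intros)
  hence s_lim: "(s \<longlongrightarrow> \<xi>) (at (\<xi> ^ q) within A)" for A
    using analytic_at_imp_isCont[OF s_an] s_at
    by (metis continuous_within isCont_def tendsto_within_subset subset_UNIV)
  have "(\<lambda>w. g (s w)) meromorphic_on {\<xi> ^ q}"
    by (rule meromorphic_on_compose[OF g(1) s_an]) (auto simp: s_at)
  moreover have ev0: "eventually (\<lambda>w. w \<noteq> 0 \<and> w \<in> ball 0 1) (at (\<xi> ^ q) within ball 0 1)"
  proof (rule eventually_conj)
    have "((\<lambda>w. w) \<longlongrightarrow> \<xi> ^ q) (at (\<xi> ^ q) within ball 0 1)" by (rule tendsto_ident_at)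
    thus "eventually (\<lambda>w. w \<noteq> 0) (at (\<xi> ^ q) within ball 0 1)"
      by (rule tendsto_imp_eventually_ne) (use \<xi> in auto)
    show "eventually (\<lambda>w. w \<in> ball 0 1) (at (\<xi> ^ q) within ball 0 1)"
      by (auto simp: eventually_at_filter)
  qed
  have "filterlim s (at \<xi> within ball 0 1) (at (\<xi> ^ q) within ball 0 1)"
    unfolding filterlim_at
  proof
    show "eventually (\<lambda>w. s w \<in> ball 0 1 \<and> s w \<noteq> \<xi>) (at (\<xi> ^ q) within ball 0 1)"
      using ev0
    proof eventually_elim
      case (elim w)
      have "norm (s w) ^ q < 1" using s_pow[of w] elim by (simp flip: norm_power)
      hence "norm (s w) < 1"
        by (meson linorder_not_less one_le_power)
      thus ?case using assms(2) by auto
    qed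
  qed (rule s_lim)
  from eventually_compose_filterlim[OF g(2) this] ev0
  have "eventually (\<lambda>w. f w = g (s w)) (at (\<xi> ^ q) within ball 0 1)"
    by eventually_elim (auto simp: s_pow)
  ultimately show ?thesis unfolding meromorphic_ext_def by blast
qed

text \<open>
  The equation is solved for its term of index \<open>d\<close>, so it transports regularity from the points
  \<open>\<xi>, \<xi>\<^sup>k, \<dots>\<close> to a further power of \<open>\<xi>\<close>. A zero of \<open>a d\<close> at \<open>\<xi>\<close> creates only a pole, which is
  why meromorphic rather than analytic extensions are considered.
\<close>

lemma meromorphic_ext_mahler_step:
  assumes eq: "\<And>z. z \<in> ball 0 1 \<Longrightarrow> (\<Sum>i\<le>d. poly (a i) z * f (z ^ (k ^ i))) = 0"
    and ad: "a d \<noteq> 0" and k: "k > 0" and \<xi>: "norm \<xi> = 1"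
    and ext: "\<And>i. i < d \<Longrightarrow> meromorphic_ext f (\<xi> ^ (k ^ i))"
  shows "meromorphic_ext f (\<xi> ^ (k ^ d))"
proof (rule meromorphic_ext_root[OF _ \<xi>])
  have "\<exists>g. g meromorphic_on {\<xi>} \<and> eventually (\<lambda>z. f (z ^ (k ^ i)) = g z) (at \<xi> within ball 0 1)"
    if "i < d" for i
    using meromorphic_ext_compose_power[OF ext[OF that] \<xi>] k by (simp add: meromorphic_ext_def)
  then obtain g where g: "\<And>i. i < d \<Longrightarrow> g i meromorphic_on {\<xi>}"
    "\<And>i. i < d \<Longrightarrow> eventually (\<lambda>z. f (z ^ (k ^ i)) = g i z) (at \<xi> within ball 0 1)"
    by metis
  define G where "G z = - (\<Sum>i<d. poly (a i) z * g i z) / poly (a d) z" for z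
  have pm: "(\<lambda>z. poly p z) meromorphic_on {\<xi>}" for p
    by (intro analytic_on_imp_meromorphic_on holomorphic_on_imp_analytic_at[of _ UNIV]
        holomorphic_intros) auto
  have "G meromorphic_on {\<xi>}"
    unfolding G_def by (intro meromorphic_intros pm g(1)) auto
  moreover have "eventually (\<lambda>z. f (z ^ (k ^ d)) = G z) (at \<xi> within ball 0 1)"
  proof -
    have "eventually (\<lambda>z. \<forall>i\<in>{..<d}. f (z ^ (k ^ i)) = g i z) (at \<xi> within ball 0 1)"
      by (rule eventually_ball_finite) (use g(2) in auto)
    moreover have "eventually (\<lambda>z. z \<in> ball 0 1) (at \<xi> within ball 0 1)"
      by (auto simp: eventually_at_filter)
    moreover note eventually_poly_nonzero[OF ad, of \<xi> "ball 0 1"]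
    ultimately show ?thesis
    proof eventually_elim
      case (elim z)
      have "(\<Sum>i<d. poly (a i) z * f (z ^ (k ^ i))) + poly (a d) z * f (z ^ (k ^ d)) = 0"
        using eq[OF elim(2)] by (simp add: lessThan_Suc_atMost[symmetric])
      also have "(\<Sum>i<d. poly (a i) z * f (z ^ (k ^ i))) = (\<Sum>i<d. poly (a i) z * g i z)"
        using elim(1) by (intro sum.cong) auto
      finally show ?case using elim(3)
        by (simp add: G_def field_simps add_eq_0_iff)
    qed
  qed
  ultimately show "meromorphic_ext (\<lambda>z. f (z ^ (k ^ d))) \<xi>"
    unfolding meromorphic_ext_def by blast
qed (use k in auto)

text \<open>
  The points \<open>\<zeta> M\<close> form a backward orbit of \<open>1\<close> under \<open>z \<mapsto> z\<^sup>k\<close>. They tend to \<open>1\<close> without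
  reaching it for large \<open>M\<close>, so all but finitely many avoid the zeros of \<open>B\<close>. The Mahler equation
  then propagates the extension down to \<open>\<zeta> 0 = 1\<close>.
\<close>

lemma meromorphic_ext_at_1:
  assumes eq: "\<And>z. z \<in> ball 0 1 \<Longrightarrow> (\<Sum>i\<le>d. poly (a i) z * f (z ^ (k ^ i))) = 0"
    and ad: "a d \<noteq> 0" and k: "k \<ge> 2"
    and B: "B \<noteq> 0"
      "\<And>\<zeta>. norm \<zeta> = 1 \<Longrightarrow> poly B \<zeta> \<noteq> 0 \<Longrightarrow> meromorphic_ext f \<zeta>"
  shows "meromorphic_ext f 1"
proof -
  define \<zeta> where "\<zeta> M = cis (2 * pi / real (k ^ M))" for M
  have \<zeta>_norm: "norm (\<zeta> M) = 1" for M by (simp add: \<zeta>_def)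
  have \<zeta>_pow: "\<zeta> (M + j) ^ (k ^ j) = \<zeta> M" for M j
    using k unfolding \<zeta>_def by (subst Complex.DeMoivre) (simp add: power_add)
  have ang_lim: "(\<lambda>M. 2 * pi / real (k ^ M)) \<longlonglongrightarrow> 0"
  proof -
    have "(\<lambda>M. 2 * pi * inverse (real k ^ M)) \<longlonglongrightarrow> 2 * pi * 0"
      using k by (intro tendsto_intros LIMSEQ_inverse_realpow_zero) auto
    thus ?thesis by (simp add: field_simps)
  qed
  have "filterlim \<zeta> (at 1) sequentially"
    unfolding filterlim_at
  proof
    have "\<zeta> \<longlonglongrightarrow> cis 0" unfolding \<zeta>_def by (intro tendsto_intros ang_lim)
    thus "\<zeta> \<longlonglongrightarrow> 1" by simp
    have "eventually (\<lambda>M. 2 * pi / real (k ^ M) < pi) sequentially"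
      by (rule order_tendstoD[OF ang_lim]) auto
    thus "eventually (\<lambda>M. \<zeta> M \<in> UNIV \<and> \<zeta> M \<noteq> 1) sequentially"
    proof eventually_elim
      case (elim M)
      have "sin (2 * pi / real (k ^ M)) > 0" using elim k by (intro sin_gt_zero) auto
      thus ?case by (auto simp: \<zeta>_def complex_eq_iff)
    qed
  qed
  from eventually_compose_filterlim[OF eventually_poly_nonzero[OF B(1)] this]
  obtain N where "\<And>M. M \<ge> N \<Longrightarrow> poly B (\<zeta> M) \<noteq> 0"
    by (auto simp: eventually_sequentially)
  hence "\<forall>M\<ge>N. meromorphic_ext f (\<zeta> M)" using B(2) \<zeta>_norm by blast
  hence "\<forall>M\<ge>0. meromorphic_ext f (\<zeta> M)"
  proof (induction N)
    case (Suc N)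
    have "meromorphic_ext f (\<zeta> (N + d) ^ (k ^ d))"
    proof (rule meromorphic_ext_mahler_step[OF eq ad])
      fix i assume "i < d"
      hence "\<zeta> (N + d) ^ (k ^ i) = \<zeta> (N + d - i)" using \<zeta>_pow[of "N + d - i" i] by simp
      thus "meromorphic_ext f (\<zeta> (N + d) ^ (k ^ i))" using Suc.prems \<open>i < d\<close> by simp
    qed (use k \<zeta>_norm in auto)
    hence "meromorphic_ext f (\<zeta> N)" by (simp add: \<zeta>_pow)
    hence "\<forall>M\<ge>N. meromorphic_ext f (\<zeta> M)" using Suc.prems by (metis not_less_eq_eq le_antisym)
    thus ?case by (rule Suc.IH)
  qed simp
  hence "meromorphic_ext f (\<zeta> 0)" by blast
  thus ?thesis by (simp add: \<zeta>_def)
qed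

text \<open>
  A meromorphic extension that vanished identically would force \<open>f = 0\<close>, so the extension has an
  integral order at \<open>\<zeta>\<close>.
\<close>

lemma meromorphic_ext_factor:
  assumes f: "f holomorphic_on ball 0 1" and z0: "z0 \<in> ball 0 1" "f z0 \<noteq> 0"
    and ext: "meromorphic_ext f \<zeta>" and \<zeta>: "norm \<zeta> = 1"
  obtains h n where "h analytic_on {\<zeta>}" "h \<zeta> \<noteq> 0"
    "eventually (\<lambda>z. f z = h z * (z - \<zeta>) powi n) (at \<zeta> within ball 0 1)"
proof -
  obtain g where g: "g meromorphic_on {\<zeta>}" "eventually (\<lambda>z. f z = g z) (at \<zeta> within ball 0 1)"
    using ext by (auto simp: meromorphic_ext_def)
  have "frequently (\<lambda>z. g z \<noteq> 0) (at \<zeta>)"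
  proof (rule ccontr)
    assume "\<not> frequently (\<lambda>z. g z \<noteq> 0) (at \<zeta>)"
    hence "eventually (\<lambda>z. g z = 0) (at \<zeta>)" by (simp add: frequently_def)
    hence "eventually (\<lambda>z. g z = 0) (at \<zeta> within ball 0 1)"
      by (rule filter_leD[OF at_le, rotated]) auto
    with g(2) have "eventually (\<lambda>z. f z = 0) (at \<zeta> within ball 0 1)"
      by eventually_elim auto
    then obtain e where e: "e > 0" "\<And>z. z \<in> ball 0 1 \<Longrightarrow> z \<noteq> \<zeta> \<Longrightarrow> dist z \<zeta> < e \<Longrightarrow> f z = 0"
      by (auto simp: eventually_at)
    have "\<zeta> \<in> closure (ball 0 1)" using \<zeta> by simp
    then obtain z1 where z1: "z1 \<in> ball 0 1" "dist z1 \<zeta> < e"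
      using e(1) unfolding closure_approachable by blast
    have "f z0 = 0"
    proof (rule analytic_continuation_open[of "ball \<zeta> e \<inter> ball 0 1" "ball 0 1" f "\<lambda>_. 0"])
      show "ball \<zeta> e \<inter> ball 0 1 \<noteq> {}" using z1 by (auto simp: dist_commute)
      show "f z = 0" if "z \<in> ball \<zeta> e \<inter> ball 0 1" for z
        using that \<zeta> by (intro e(2)) (auto simp: dist_commute)
    qed (use f z0 in auto)
    with z0 show False by simp
  qed
  moreover have "isolated_singularity_at g \<zeta>" "not_essential g \<zeta>"
    using g(1) by (auto simp: meromorphic_at_iff)
  ultimately obtain r where r: "zor_poly g \<zeta> \<zeta> \<noteq> 0" "r > 0" "zor_poly g \<zeta> holomorphic_on cball \<zeta> r"
    "\<And>w. w \<in> cball \<zeta> r - {\<zeta>} \<Longrightarrow> g w = zor_poly g \<zeta> w * (w - \<zeta>) powi zorder g \<zeta>"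
    using zorder_exist[of g \<zeta>] by blast
  show ?thesis
  proof (rule that)
    show "zor_poly g \<zeta> analytic_on {\<zeta>}" using r(2,3)
      by (auto simp: analytic_at intro!: exI[of _ "ball \<zeta> r"] intro: holomorphic_on_subset)
    have "eventually (\<lambda>w. w \<in> cball \<zeta> r - {\<zeta>}) (at \<zeta> within ball 0 1)"
      unfolding eventually_at using r(2) by (auto simp: dist_commute intro!: exI[of _ r])
    with g(2) show "eventually (\<lambda>z. f z = zor_poly g \<zeta> z * (z - \<zeta>) powi zorder g \<zeta>) (at \<zeta> within ball 0 1)"
      by eventually_elim (use r(4) in auto)
  qed (use r in auto)
qed

section \<open>Asymptotics along the radius to 1\<close>

lemma filterlim_of_real_at_left_1:
  "filterlim of_real (at (1::complex) within ball 0 1) (at_left (1::real))"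
  unfolding filterlim_at
proof
  have "eventually (\<lambda>x::real. x \<in> {0<..<1}) (at_left 1)"
    by (rule eventually_at_left_real) simp
  thus "eventually (\<lambda>x. complex_of_real x \<in> ball 0 1 \<and> complex_of_real x \<noteq> 1) (at_left 1)"
    by eventually_elim auto
  have "((\<lambda>x. complex_of_real x) \<longlongrightarrow> of_real 1) (at_left 1)" by (intro tendsto_intros)
  thus "(complex_of_real \<longlongrightarrow> 1) (at_left 1)" by simp
qed

lemma filterlim_power_at_left_1:
  assumes "q > 0"
  shows "filterlim (\<lambda>x::real. x ^ q) (at_left 1) (at_left 1)"
  unfolding filterlim_at
proof
  have "eventually (\<lambda>x::real. x \<in> {0<..<1}) (at_left 1)"
    by (rule eventually_at_left_real) simp
  thus "eventually (\<lambda>x::real. x ^ q \<in> {..<1} \<and> x ^ q \<noteq> 1) (at_left 1)"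
  proof eventually_elim
    case (elim x)
    hence "x ^ q < 1" using assms by (simp add: power_less_one_iff)
    thus ?case by simp
  qed
  have "((\<lambda>x::real. x ^ q) \<longlongrightarrow> 1 ^ q) (at_left 1)" by (intro tendsto_intros)
  thus "((\<lambda>x::real. x ^ q) \<longlongrightarrow> 1) (at_left 1)" by simp
qed

lemma tendsto_power_quotient:
  "((\<lambda>x::real. (x ^ q - 1) / (x - 1)) \<longlongrightarrow> real q) (at_left 1)"
proof -
  have "((\<lambda>x::real. \<Sum>i<q. x ^ i) \<longlongrightarrow> (\<Sum>i<q. 1 ^ i)) (at_left 1)"
    by (intro tendsto_intros)
  hence "((\<lambda>x::real. \<Sum>i<q. x ^ i) \<longlongrightarrow> real q) (at_left 1)" by simp
  moreover have "eventually (\<lambda>x::real. (\<Sum>i<q. x ^ i) = (x ^ q - 1) / (x - 1)) (at_left 1)"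
    by (auto simp: eventually_at_filter power_diff_1_eq)
  ultimately show ?thesis by (rule Lim_transform_eventually)
qed

text \<open>
  The exponent being an integer, \<open>(z\<^sup>q - 1)\<^sup>n\<close> divided by \<open>(z - 1)\<^sup>n\<close> is the \<open>n\<close>-th power of a quotient
  tending to \<open>q\<close>.
\<close>

lemma tendsto_dilated:
  assumes h: "h analytic_on {1}" and q: "q > 0"
    and f: "eventually (\<lambda>z. f z = h z * (z - 1) powi n) (at 1 within ball 0 1)"
  shows "((\<lambda>x. f (of_real x ^ q) / (of_real x - 1) powi n) \<longlongrightarrow> h 1 * of_nat q powi n) (at_left (1::real))"
proof -
  note lim = filterlim_compose[OF filterlim_of_real_at_left_1 filterlim_power_at_left_1[OF q]]
  have "(h \<longlongrightarrow> h 1) (at 1 within ball 0 1)"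
    using analytic_at_imp_isCont[OF h] unfolding isCont_def by (rule tendsto_within_subset) simp
  from filterlim_compose[OF this lim]
  have h_lim: "((\<lambda>x. h (of_real (x ^ q))) \<longlongrightarrow> h 1) (at_left (1::real))" .
  have "((\<lambda>x. complex_of_real ((x ^ q - 1) / (x - 1))) \<longlongrightarrow> of_real (real q)) (at_left 1)"
    by (intro tendsto_of_real tendsto_power_quotient)
  hence "((\<lambda>x. h (of_real (x ^ q)) * complex_of_real ((x ^ q - 1) / (x - 1)) powi n)
      \<longlongrightarrow> h 1 * of_real (real q) powi n) (at_left 1)"
    by (rule tendsto_mult[OF h_lim tendsto_power_int]) (use q in auto)
  hence lim': "((\<lambda>x. h (of_real (x ^ q)) * complex_of_real ((x ^ q - 1) / (x - 1)) powi n)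
      \<longlongrightarrow> h 1 * of_nat q powi n) (at_left 1)" by simp
  show ?thesis
  proof (rule Lim_transform_eventually[OF lim'])
    show "eventually (\<lambda>x. h (of_real (x ^ q)) * complex_of_real ((x ^ q - 1) / (x - 1)) powi n =
        f (of_real x ^ q) / (of_real x - 1) powi n) (at_left 1)"
      using eventually_compose_filterlim[OF f lim]
      by eventually_elim (simp add: power_int_divide_distrib)
  qed
qed

lemma char_poly_powi_eq_0:
  assumes k: "k > 0" and f: "eventually (\<lambda>z. f z = h z * (z - 1) powi n) (at 1 within ball 0 1)"
    and h: "h analytic_on {1}" "h 1 \<noteq> 0"
    and eq: "\<And>z. z \<in> ball 0 1 \<Longrightarrow> (\<Sum>i\<le>d. poly (a i) z * f (z ^ (k ^ i))) = 0"
  shows "poly (mahler_char_poly d a) (of_nat k powi (-n)) = 0"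
proof -
  have "((\<lambda>x::real. \<Sum>i\<le>d. poly (a i) (of_real x) * (f (of_real x ^ (k ^ i)) / (of_real x - 1) powi n))
     \<longlongrightarrow> (\<Sum>i\<le>d. poly (a i) (of_real 1) * (h 1 * of_nat (k ^ i) powi n))) (at_left 1)"
    by (intro tendsto_intros tendsto_dilated f h) (use k in auto)
  moreover have "eventually (\<lambda>x::real. (\<Sum>i\<le>d. poly (a i) (of_real x) *
      (f (of_real x ^ (k ^ i)) / (of_real x - 1) powi n)) = 0) (at_left 1)"
  proof -
    have "eventually (\<lambda>x::real. x \<in> {0<..<1}) (at_left 1)"
      by (rule eventually_at_left_real) simp
    thus ?thesis
    proof eventually_elim
      case (elim x)
      show ?case using eq[of "of_real x"] elim
        by (simp flip: sum_divide_distrib)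
    qed
  qed
  ultimately have "(\<Sum>i\<le>d. poly (a i) 1 * (h 1 * of_nat (k ^ i) powi n)) = 0"
    using tendsto_unique[OF trivial_limit_at_left_real _ tendsto_eventually] by fastforce
  also have "(\<Sum>i\<le>d. poly (a i) 1 * (h 1 * of_nat (k ^ i) powi n)) =
      h 1 * (\<Sum>i\<le>d. poly (a i) 1 * (of_nat k powi n) ^ i)"
  proof -
    have "of_nat (k ^ i) powi n = (of_nat k powi n :: complex) ^ i" for i
      by (induction i) (simp_all add: power_int_mult_distrib)
    thus ?thesis by (simp add: sum_distrib_left mult.left_commute)
  qed
  finally have "(\<Sum>i\<le>d. poly (a i) 1 * (of_nat k powi n) ^ i) = 0" using h by simp
  moreover have "poly (mahler_char_poly d a) (of_nat k powi (-n)) =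
      (of_nat k powi (-n)) ^ d * (\<Sum>i\<le>d. poly (a i) 1 * (of_nat k powi n) ^ i)"
    unfolding mahler_char_poly_def poly_sum poly_monom sum_distrib_left
  proof (rule sum.cong)
    fix i assume "i \<in> {..d}"
    thus "poly (a i) 1 * (of_nat k powi (-n)) ^ (d - i) =
      (of_nat k powi (-n)) ^ d * (poly (a i) 1 * (of_nat k powi n) ^ i)"
      using k by (simp add: power_int_minus power_diff field_simps)
  qed simp
  ultimately show ?thesis by simp
qed

text \<open>
  In the quotient of the asymptotic formulas at \<open>x\<^sup>k\<close> and \<open>x\<close> the oscillating factor cancels because
  \<open>C(x\<^sup>k) = C(x)\<close>, and what remains tends to \<open>exp (- log\<^sub>k l \<cdot> ln k) = 1 / l\<close>. The local factorisation
  at \<open>1\<close> gives the limit \<open>k\<^sup>n\<close> for the same quotient.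
\<close>

lemma eigenvalue_eq_powi:
  assumes k: "k \<ge> 2" and F: "eventually (\<lambda>z. eval_fps F z = h z * (z - 1) powi n) (at 1 within ball 0 1)"
    and h: "h analytic_on {1}" "h 1 \<noteq> 0"
    and l: "mahler_eigenvalue k d a F l"
  shows "l = of_nat k powi (-n)"
proof -
  define f where "f = eval_fps F"
  obtain C m o1 where C: "m > 0" "\<And>x. x \<in> {0<..<1} \<Longrightarrow> m \<le> norm (C x)"
      "\<And>x. x \<in> {0<..<1::real} \<Longrightarrow> C x = (C (x ^ k) :: complex)"
    and o1: "o1 \<in> o[at_left 1](\<lambda>_. 1)" 
    and asym: "eventually (\<lambda>x. f (of_real x) = C x / exp (clog k l * of_real (ln (1 - x))) * (1 + o1 x)) (at_left 1)"
    and l0: "l \<noteq> 0"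
    using l unfolding mahler_eigenvalue_def f_def by blast
  have pow_lim: "filterlim (\<lambda>x::real. x ^ k) (at_left 1) (at_left 1)"
    using k by (intro filterlim_power_at_left_1) simp
  have o1_lim: "(o1 \<longlongrightarrow> 0) (at_left 1)" using smalloD_tendsto[OF o1] by simp
  have o1_lim': "((\<lambda>x. o1 (x ^ k)) \<longlongrightarrow> 0) (at_left 1)"
    by (rule filterlim_compose[OF o1_lim pow_lim])
  define E where "E x = (1 + o1 (x ^ k)) / (1 + o1 x) *
     exp (- (clog k l * of_real (ln ((x ^ k - 1) / (x - 1)))))" for x
  have ev01: "eventually (\<lambda>x::real. x \<in> {0<..<1}) (at_left 1)"
    by (rule eventually_at_left_real) simp
  have "(E \<longlongrightarrow> (1 + 0) / (1 + 0) * exp (- (clog k l * of_real (ln (real k))))) (at_left 1)"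
    unfolding E_def using k by (intro tendsto_intros o1_lim o1_lim' tendsto_power_quotient) auto
  also have "clog k l * of_real (ln (real k)) = Ln l" using k by (simp add: clog_def)
  also have "(1 + 0) / (1 + 0) * exp (- Ln l) = 1 / l" using l0 by (simp add: exp_minus field_simps)
  finally have E_lim: "(E \<longlongrightarrow> 1 / l) (at_left 1)" .
  have f1: "((\<lambda>x. f (of_real x ^ q) / (of_real x - 1) powi n) \<longlongrightarrow> h 1 * of_nat q powi n) (at_left (1::real))"
    if "q > 0" for q using tendsto_dilated[OF h(1) that F] by (simp add: f_def)
  have "((\<lambda>x. (f (of_real x ^ k) / (of_real x - 1) powi n) / (f (of_real x ^ 1) / (of_real x - 1) powi n))
     \<longlongrightarrow> (h 1 * of_nat k powi n) / (h 1 * of_nat 1 powi n)) (at_left (1::real))"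
    by (intro tendsto_divide f1) (use k h in auto)
  hence ratio: "((\<lambda>x. (f (of_real x ^ k) / (of_real x - 1) powi n) / (f (of_real x ^ 1) / (of_real x - 1) powi n))
     \<longlongrightarrow> of_nat k powi n) (at_left (1::real))" using h by simp
  have "eventually (\<lambda>x. 1 + o1 x \<noteq> 0) (at_left 1)"
    by (rule tendsto_imp_eventually_ne[OF tendsto_add[OF tendsto_const o1_lim]]) auto
  with ev01 asym eventually_compose_filterlim[OF asym pow_lim]
  have "eventually (\<lambda>x. (f (of_real x ^ k) / (of_real x - 1) powi n) / (f (of_real x ^ 1) / (of_real x - 1) powi n)
     = E x) (at_left (1::real))"
  proof eventually_elim
    case (elim x)
    have x: "0 < x" "x < 1" using elim by auto
    have xk: "0 < x ^ k" "x ^ k < 1" using x k by (auto simp: power_less_one_iff)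
    have Cx: "C x \<noteq> 0" "C (x ^ k) = C x" using C elim by fastforce+
    have pw: "(complex_of_real x - 1) powi n \<noteq> 0" using x by simp
    have "(x ^ k - 1) / (x - 1) = (1 - x ^ k) / (1 - x)" using x by (simp add: field_simps)
    hence ln: "ln ((x ^ k - 1) / (x - 1)) = ln (1 - x ^ k) - ln (1 - x)"
      using x xk by (simp add: ln_div)
    have "f (of_real x ^ k) = C x / exp (clog k l * of_real (ln (1 - x ^ k))) * (1 + o1 (x ^ k))"
      using elim(3) k Cx by simp
    moreover have "f (of_real x ^ 1) = C x / exp (clog k l * of_real (ln (1 - x))) * (1 + o1 x)"
      using elim(2) by simp
    moreover have "exp (- (clog k l * of_real (ln ((x ^ k - 1) / (x - 1))))) =
        exp (clog k l * of_real (ln (1 - x))) / exp (clog k l * of_real (ln (1 - x ^ k)))"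
      unfolding ln by (simp add: algebra_simps flip: exp_diff)
    moreover have "(c / e' * u / w) / (c / e * v / w) = u / v * (e / e')"
      if "c \<noteq> 0" "w \<noteq> 0" "e \<noteq> 0" "e' \<noteq> 0" "v \<noteq> 0" for c e e' u v w :: complex
      using that by (simp add: field_simps)
    ultimately show ?case using Cx(1) pw elim(4) unfolding E_def by simp
  qed
  with ratio have "(E \<longlongrightarrow> of_nat k powi n) (at_left 1)" by (rule Lim_transform_eventually)
  with E_lim have "1 / l = of_nat k powi n" by (intro tendsto_unique[of "at_left 1"]) auto
  thus ?thesis by (metis power_int_minus inverse_eq_divide inverse_inverse_eq)
qed

section \<open>The transcendence criterion\<close>

theorem mainTheorem1:
  fixes k d :: nat and F :: "complex fps" and a :: "nat \<Rightarrow> complex poly"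
  assumes "k \<ge> 2" and "d \<ge> 1"
    and "F \<noteq> 0" and "mahler_function k F" and "fps_conv_radius F \<ge> 1"
    and "mahler_equation k d a F"
    and "poly (a 0) 1 * poly (a d) 1 \<noteq> 0"
    and "card {l. poly (mahler_char_poly d a) l = 0} = d"
    and "(\<forall>n::int. poly (mahler_char_poly d a) (of_nat k powi n) \<noteq> 0) \<or>
         (\<exists>l. mahler_eigenvalue k d a F l \<and> (\<forall>n::int. l \<noteq> of_nat k powi n))"
  shows "transcendental_over rat_funs (fps_to_fls F)"
proof (rule ccontr)
  define f where "f = eval_fps F"
  note F = \<open>fps_conv_radius F \<ge> 1\<close> and k = \<open>k \<ge> 2\<close>
  have f_hol: "f holomorphic_on ball 0 1"
    unfolding f_def by (rule holomorphic_on_eval_fps_unit_disc[OF F])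
  have eq: "(\<Sum>i\<le>d. poly (a i) z * f (z ^ (k ^ i))) = 0" if "z \<in> ball 0 1" for z
    unfolding f_def using k that
    by (intro mahler_equation_eval[OF \<open>mahler_equation k d a F\<close> F]) auto
  have ad: "a d \<noteq> 0" using \<open>poly (a 0) 1 * poly (a d) 1 \<noteq> 0\<close> by auto
  have "\<exists>z0\<in>ball 0 1. f z0 \<noteq> 0"
  proof (rule ccontr)
    assume "\<not> (\<exists>z0\<in>ball 0 1. f z0 \<noteq> 0)"
    hence "eventually (\<lambda>z. f z = 0) (nhds 0)"
      using eventually_nhds_in_open[of "ball 0 1" "0::complex"] by (auto elim: eventually_mono)
    hence "f has_fps_expansion 0" by (simp add: has_fps_expansion_0_iff)
    hence "F = 0"
      using has_fps_expansion_unit_disc[OF F] fps_expansion_unique_complex unfolding f_def by blast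
    with \<open>F \<noteq> 0\<close> show False by contradiction
  qed
  then obtain z0 where z0: "z0 \<in> ball 0 1" "f z0 \<noteq> 0" by blast
  assume "\<not> transcendental_over rat_funs (fps_to_fls F)"
  then obtain p0 where p0: "p0 \<noteq> 0" "\<And>z. z \<in> ball 0 1 \<Longrightarrow> eval2 p0 z (f z) = 0"
    unfolding f_def using algebraic_imp_eval2[OF _ F] by metis
  obtain p b R where p: "p \<noteq> 0" "\<And>z. z \<in> ball 0 1 \<Longrightarrow> eval2 p z (f z) = 0" and R: "R \<noteq> 0"
    "\<And>z. z \<in> ball 0 1 \<Longrightarrow> eval2 b z (f z) * eval2 (pderiv p) z (f z) = poly R z"
    using ex_separable_annihilator[OF f_hol p0] by metis
  have "meromorphic_ext f 1"
  proof (rule meromorphic_ext_at_1[where B = "R * lead_coeff p", OF eq ad k])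
    fix \<zeta> :: complex assume \<zeta>: "norm \<zeta> = 1" "poly (R * lead_coeff p) \<zeta> \<noteq> 0"
    then obtain g where "g analytic_on {\<zeta>}" "eventually (\<lambda>z. f z = g z) (at \<zeta> within ball 0 1)"
      using algebraic_analytic_continuation[OF f_hol p(2) R(2) \<zeta>(1)] by auto
    thus "meromorphic_ext f \<zeta>"
      unfolding meromorphic_ext_def using analytic_on_imp_meromorphic_on by blast
  qed (use R p in auto)
  then obtain h n where h: "h analytic_on {1}" "h 1 \<noteq> 0"
    and f1: "eventually (\<lambda>z. f z = h z * (z - 1) powi n) (at 1 within ball 0 1)"
    using meromorphic_ext_factor[OF f_hol z0, of 1] by auto
  have root: "poly (mahler_char_poly d a) (of_nat k powi (-n)) = 0"
    using k by (intro char_poly_powi_eq_0[OF _ f1 h eq]) auto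
  have "l = of_nat k powi (-n)" if "mahler_eigenvalue k d a F l" for l
    using eigenvalue_eq_powi[OF k f1[unfolded f_def] h that] .
  with root assms(9) show False by blast
qed

end
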